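(* Let $L:A\to A$ be a derivation, let $q\in A$, and let $\eta\in A$ be any particular solution of $(L+q)\psi=0$, i.e. $\eta\in\operatorname{Ker}(L+q)$. Then the set of solutions of $(L+q)\psi=0$ is given by $$\operatorname{Ker}(L+q)=\eta\operatorname{Ker}L=\{\eta\phi:\phi\in A,\ L\phi=0\}.$$
   Context: $A$ is a field of characteristic $0$, and $K\cong\mathbb{Q}$ is its subfield generated by $1$. $A$ is generated as a field by a set $\{x_1,\dots,x_n\}$ of $n$ distinct elements, different from $0$ and $1$, which is algebraically independent over $K$. $A$ is also assumed to carry a partial order $\le$ such that $\psi_1>\psi_2$ and $\varphi_1\ge\varphi_2$ imply $\psi_1+\varphi_1>\psi_2+\varphi_2$, and $\psi^2\ge 0$ for all $\psi\in A$. A derivation is a $K$-linear map $L:A\to A$ with $L(\psi\varphi)=\psi L\varphi+\varphi L\psi$. For $q\in A$, the operator $L+q:A\to A$ is $(L+q)\psi=L\psi+q\psi$; $\operatorname{Ker}$ denotes the set of elements of $A$ sent to $0$.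
   Formalization: The particular solution η is assumed to be nonzero; for η = 0 the claim fails, e.g. with q = 0, where η Ker L = {0} but Ker L contains K. *)

theory Defs
  imports Complex_Main "HOL-Library.Poly_Mapping"
begin

definition is_subfield :: "'a::field set \<Rightarrow> bool" where
  "is_subfield F \<longleftrightarrow> 1 \<in> F \<and> (\<forall>a\<in>F. \<forall>b\<in>F. a - b \<in> F \<and> a * b \<in> F)
     \<and> (\<forall>a\<in>F. inverse a \<in> F)"

abbreviation generated_field :: "'a::field set \<Rightarrow> 'a set" where
  "generated_field S \<equiv> is_subfield hull S"

abbreviation prime_subfield :: "'a::field set" where
  "prime_subfield \<equiv> generated_field {1}"

lemma is_subfield_Rats: "is_subfield (\<rat> :: 'a::field_char_0 set)"
  by (auto simp: is_subfield_def)

lemma is_subfield_contains_Rats: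
  assumes F: "is_subfield (F :: 'a::field_char_0 set)"
  shows "\<rat> \<subseteq> F"
proof -
  have one: "1 \<in> F" and diff: "\<And>a b. a \<in> F \<Longrightarrow> b \<in> F \<Longrightarrow> a - b \<in> F"
    and mult: "\<And>a b. a \<in> F \<Longrightarrow> b \<in> F \<Longrightarrow> a * b \<in> F"
    and inv: "\<And>a. a \<in> F \<Longrightarrow> inverse a \<in> F"
    using F by (auto simp: is_subfield_def)
  have zero: "0 \<in> F" using diff[OF one one] by simp
  have neg: "- a \<in> F" if "a \<in> F" for a using diff[OF zero that] by simp
  have add: "a + b \<in> F" if "a \<in> F" "b \<in> F" for a b using diff[OF that(1) neg[OF that(2)]] by simp
  have nat: "of_nat k \<in> F" for k :: nat
    by (induction k) (auto intro: zero one add)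
  have int: "of_int k \<in> F" for k :: int
    by (cases k rule: int_cases2) (auto intro: nat neg)
  show ?thesis
  proof
    fix r :: 'a assume "r \<in> \<rat>"
    then obtain a b where "r = of_int a / of_int b" by (elim Rats_cases') auto
    then show "r \<in> F" by (simp add: divide_inverse int inv mult)
  qed
qed

lemma prime_subfield_eq_Rats: "prime_subfield = (\<rat> :: 'a::field_char_0 set)"
proof
  show "prime_subfield \<subseteq> (\<rat> :: 'a set)"
    by (intro hull_minimal) (auto intro: is_subfield_Rats)
  show "(\<rat> :: 'a set) \<subseteq> prime_subfield"
    unfolding hull_def using is_subfield_contains_Rats by blast
qed

text \<open>Polynomials in variables indexed by \<open>'i\<close> are finitely supported maps from monomials to
  coefficients; a monomial is a finitely supported map from variables to exponents.\<close>

definition poly_value :: "('i \<Rightarrow> 'a::field) \<Rightarrow> (('i \<Rightarrow>\<^sub>0 nat) \<Rightarrow>\<^sub>0 'a) \<Rightarrow> 'a" where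
  "poly_value x p =
     (\<Sum>m\<in>Poly_Mapping.keys p.
        Poly_Mapping.lookup p m * (\<Prod>i\<in>Poly_Mapping.keys m. x i ^ Poly_Mapping.lookup m i))"

definition algebraically_independent :: "'a::field set \<Rightarrow> 'i set \<Rightarrow> ('i \<Rightarrow> 'a) \<Rightarrow> bool" where
  "algebraically_independent K I x \<longleftrightarrow>
     (\<forall>p. (\<forall>m. Poly_Mapping.lookup p m \<in> K) \<longrightarrow>
          (\<forall>m\<in>Poly_Mapping.keys p. Poly_Mapping.keys m \<subseteq> I) \<longrightarrow>
          poly_value x p = 0 \<longrightarrow> p = 0)"

definition derivation :: "('a::field \<Rightarrow> 'a) \<Rightarrow> bool" where
  "derivation L \<longleftrightarrow>
     (\<forall>\<psi> \<phi>. L (\<psi> + \<phi>) = L \<psi> + L \<phi>) \<and>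
     (\<forall>c\<in>prime_subfield. \<forall>\<psi>. L (c * \<psi>) = c * L \<psi>) \<and>
     (\<forall>\<psi> \<phi>. L (\<psi> * \<phi>) = \<psi> * L \<phi> + \<phi> * L \<psi>)"

definition op_add :: "('a::field \<Rightarrow> 'a) \<Rightarrow> 'a \<Rightarrow> 'a \<Rightarrow> 'a" where
  "op_add L q = (\<lambda>\<psi>. L \<psi> + q * \<psi>)"

definition Ker :: "('a::field \<Rightarrow> 'a) \<Rightarrow> 'a set" where
  "Ker T = {\<psi>. T \<psi> = 0}"

end

theory Submission imports Defs begin

text \<open>
  If \<open>\<eta>\<close> is a solution, the Leibniz rule gives \<open>(L + q)(\<eta> \<phi>) = \<eta> L \<phi> + \<phi> (L + q) \<eta> = \<eta> L \<phi>\<close> for every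
  \<open>\<phi>\<close> (\<open>op_add_mult_solution\<close>). In a field with \<open>\<eta> \<noteq> 0\<close>, every \<open>\<psi>\<close> has the form \<open>\<eta> \<phi>\<close> with
  \<open>\<phi> = \<psi> / \<eta>\<close>, and \<open>\<eta> L \<phi>\<close> vanishes exactly when \<open>L \<phi>\<close> does.
\<close>

lemma op_add_mult_solution:
  assumes "derivation L" and "\<eta> \<in> Ker (op_add L q)"
  shows "op_add L q (\<eta> * \<phi>) = \<eta> * L \<phi>"
proof -
  have "op_add L q (\<eta> * \<phi>) = \<eta> * L \<phi> + \<phi> * op_add L q \<eta>"
    using assms(1) by (simp add: derivation_def op_add_def algebra_simps)
  then show ?thesis
    using assms(2) by (simp add: Ker_def)
qed

lemma Ker_op_add_eq_image:
  fixes \<eta> :: "'a::field"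
  assumes "derivation L" and "\<eta> \<in> Ker (op_add L q)" and "\<eta> \<noteq> 0"
  shows "Ker (op_add L q) = (\<lambda>\<phi>. \<eta> * \<phi>) ` Ker L"
proof
  show "Ker (op_add L q) \<subseteq> (\<lambda>\<phi>. \<eta> * \<phi>) ` Ker L"
  proof
    fix \<psi> assume \<psi>: "\<psi> \<in> Ker (op_add L q)"
    have eq: "\<psi> = \<eta> * (\<psi> / \<eta>)"
      using assms(3) by simp
    have "\<eta> * L (\<psi> / \<eta>) = op_add L q \<psi>"
      using op_add_mult_solution[OF assms(1,2), of "\<psi> / \<eta>"] eq by simp
    then have "\<psi> / \<eta> \<in> Ker L"
      using \<psi> assms(3) by (simp add: Ker_def)
    with eq show "\<psi> \<in> (\<lambda>\<phi>. \<eta> * \<phi>) ` Ker L"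
      by (rule image_eqI)
  qed
  show "(\<lambda>\<phi>. \<eta> * \<phi>) ` Ker L \<subseteq> Ker (op_add L q)"
    using op_add_mult_solution[OF assms(1,2)] by (auto simp: Ker_def)
qed

theorem proposition2:
  fixes n :: nat and x :: "nat \<Rightarrow> 'a::{field_char_0, order}"
    and L :: "'a \<Rightarrow> 'a" and q \<eta> :: 'a
  assumes "inj_on x {1..n}"
    and "\<forall>i\<in>{1..n}. x i \<noteq> 0 \<and> x i \<noteq> 1"
    and "generated_field (x ` {1..n}) = UNIV"
    and "algebraically_independent prime_subfield {1..n} x"
    and "\<And>\<psi>1 \<psi>2 \<phi>1 \<phi>2 :: 'a. \<psi>1 > \<psi>2 \<Longrightarrow> \<phi>1 \<ge> \<phi>2 \<Longrightarrow> \<psi>1 + \<phi>1 > \<psi>2 + \<phi>2"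
    and "\<And>\<psi> :: 'a. \<psi>\<^sup>2 \<ge> 0"
    and "derivation L"
    and "\<eta> \<in> Ker (op_add L q)"
    and "\<eta> \<noteq> 0"
  shows "Ker (op_add L q) = (\<lambda>\<phi>. \<eta> * \<phi>) ` Ker L \<and>
         (\<lambda>\<phi>. \<eta> * \<phi>) ` Ker L = {\<eta> * \<phi> |\<phi>. L \<phi> = 0}"
proof
  show "Ker (op_add L q) = (\<lambda>\<phi>. \<eta> * \<phi>) ` Ker L"
    using assms(7-9) by (rule Ker_op_add_eq_image)
  show "(\<lambda>\<phi>. \<eta> * \<phi>) ` Ker L = {\<eta> * \<phi> |\<phi>. L \<phi> = 0}"
    by (auto simp: Ker_def)
qed

end
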